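(* Let $(S_n)_{n\in\mathbb Z}$ be a sequence of finite or countably infinite state spaces and let $(Z_n)_{n\in\mathbb Z}$ be a (possibly nonhomogeneous) Markov chain indexed by $\mathbb Z$ on a probability space $(\Omega,\mathcal F,P)$, with $Z_n$ taking values in $S_n$. Let $A\in\mathcal H=\bigcap_{n\le 0}\sigma(\dots,Z_{n-1},Z_n)$ and, for $0\le a\le b\le 1$, let $S_n(a,b)=\{i\in S_n: a\le P(A\mid Z_n=i)\le b\}$. If $0<p<q<1$, then: a) $\lim_{n\to-\infty}P(Z_n\in S_n(q,1))=P(A)$, b) $\lim_{n\to-\infty}P(Z_n\in S_n(p,q))=0$, c) $\lim_{n\to-\infty}P(Z_n\in S_n(0,p))=1-P(A)$; and moreover, as $n\to-\infty$, a') $P\big(\{Z_n\in S_n(q,1)\}\bigtriangleup A\big)\to 0$, b') $P\big(\{Z_n\in S_n(p,q)\}\big)\to 0$, c') $P\big(\{Z_n\in S_n(0,p)\}\bigtriangleup A^c\big)\to 0$.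
   Context: A Markov chain indexed by $\mathbb Z$ means a family of random variables $(Z_n)_{n\in\mathbb Z}$ satisfying the Markov property: for all integers $k\le n$, $P(Z_{n+1}=j\mid Z_k=i_k,\dots,Z_n=i_n)=P(Z_{n+1}=j\mid Z_n=i_n)$ whenever the conditioning event on the left has positive probability. The $\sigma$-algebra $\mathcal H$ is called the entrance $\sigma$-algebra. The state spaces carry the discrete $\sigma$-algebra. $\bigtriangleup$ is the symmetric difference and $A^c$ the complement of $A$. $P(A\mid Z_n=i)$ is the elementary conditional probability; states $i$ with $P(Z_n=i)=0$ play no role, since they do not affect the probabilities in the conclusion. *)

theory Defs
  imports "HOL-Probability.Probability"
begin

definition markov_chain :: "'w measure \<Rightarrow> (int \<Rightarrow> 'a set) \<Rightarrow> (int \<Rightarrow> 'w \<Rightarrow> 'a) \<Rightarrow> bool" where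
  "markov_chain M S Z \<longleftrightarrow>
     (\<forall>n. Z n \<in> measurable M (count_space (S n))) \<and>
     (\<forall>k n i j. k \<le> n \<longrightarrow> (\<forall>m\<in>{k..n}. i m \<in> S m) \<longrightarrow> j \<in> S (n + 1) \<longrightarrow>
        \<P>(\<omega> in M. \<forall>m\<in>{k..n}. Z m \<omega> = i m) > 0 \<longrightarrow>
        \<P>(\<omega> in M. Z (n + 1) \<omega> = j \<bar> \<forall>m\<in>{k..n}. Z m \<omega> = i m) =
        \<P>(\<omega> in M. Z (n + 1) \<omega> = j \<bar> Z n \<omega> = i n))"

definition past_sigma :: "'w measure \<Rightarrow> (int \<Rightarrow> 'a set) \<Rightarrow> (int \<Rightarrow> 'w \<Rightarrow> 'a) \<Rightarrow> int \<Rightarrow> 'w set set" where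
  "past_sigma M S Z n =
     sigma_sets (space M) (\<Union>m\<in>{..n}. {Z m -` B \<inter> space M | B. B \<subseteq> S m})"

definition entrance_sigma :: "'w measure \<Rightarrow> (int \<Rightarrow> 'a set) \<Rightarrow> (int \<Rightarrow> 'w \<Rightarrow> 'a) \<Rightarrow> 'w set set" where
  "entrance_sigma M S Z = (\<Inter>n\<in>{..0}. past_sigma M S Z n)"

text \<open>A state of probability zero has conditional probability \<open>0 / 0 = 0\<close>, so it is
  counted in the set below exactly when \<open>a \<le> 0 \<le> b\<close>; such states form a null event.\<close>

definition level_states ::
    "'w measure \<Rightarrow> (int \<Rightarrow> 'a set) \<Rightarrow> (int \<Rightarrow> 'w \<Rightarrow> 'a) \<Rightarrow> 'w set \<Rightarrow> int \<Rightarrow> real \<Rightarrow> real \<Rightarrow> 'a set" where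
  "level_states M S Z A n a b =
     {i \<in> S n. a \<le> \<P>(\<omega> in M. \<omega> \<in> A \<bar> Z n \<omega> = i) \<and> \<P>(\<omega> in M. \<omega> \<in> A \<bar> Z n \<omega> = i) \<le> b}"

end

theory Submission
  imports Defs
begin

text \<open>
  Write \<open>g\<^sub>n(i) = P(A | Z\<^sub>n = i)\<close>. An entrance event \<open>A\<close> belongs to the past of every time
  \<open>n \<le> 0\<close>. The Markov property, read with past and future exchanged, says that given \<open>Z\<^sub>n\<close> such
  an event is independent of the later states up to \<open>Z\<^sub>0\<close>; hence on every path event
  \<open>E = {Z\<^sub>n = c\<^sub>n, \<dots>, Z\<^sub>0 = c\<^sub>0}\<close> one has \<open>P(A \<inter> E) = g\<^sub>n(c\<^sub>n) P(E)\<close>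
  (lemma \<open>past_given_path\<close>). On the other hand \<open>A\<close> is determined by \<open>(Z\<^sub>m)\<close> for \<open>m \<le> 0\<close>, so up
  to a small error in probability it is an event \<open>B\<close> that depends on \<open>Z\<^sub>k, \<dots>, Z\<^sub>0\<close> only
  (lemma \<open>approximable_past\<close>).

  These two facts replace Levy's martingale convergence theorem. Let \<open>n \<le> k\<close> and let \<open>J\<close> be an
  event \<open>Z\<^sub>n \<in> I\<close> such that \<open>g\<^sub>n \<ge> d\<close> on \<open>I\<close> and \<open>g\<^sub>n \<le> 1 - d\<close> off \<open>I\<close>. Both \<open>J\<close> and \<open>B\<close>
  are unions of path events \<open>E\<close>. If \<open>E\<close> lies in exactly one of them, then the proportion of \<open>E\<close>
  on which \<open>A\<close> and \<open>B\<close> disagree is \<open>g\<^sub>n(c\<^sub>n)\<close> or \<open>1 - g\<^sub>n(c\<^sub>n)\<close>, and in either case at least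
  \<open>d\<close>. Summing over the countably many paths bounds \<open>d P(J \<triangle> B)\<close> by \<open>P(A \<triangle> B)\<close>
  (lemma \<open>state_set_vs_block\<close>). So \<open>P(J \<triangle> A)\<close> is small for all sufficiently negative \<open>n\<close>.

  The high and low level sets both satisfy the condition on \<open>I\<close> (the low one after taking the
  complement). A state of intermediate level lies in \<open>S\<^sub>n(p,1)\<close> and in \<open>S\<^sub>n(0,q)\<close>, which approach
  disjoint events.
\<close>

section \<open>Paths of a Markov chain with countable state spaces\<close>

locale countable_markov_chain = prob_space M
  for M :: "'w measure" +
  fixes S :: "int \<Rightarrow> 'a set" and Z :: "int \<Rightarrow> 'w \<Rightarrow> 'a"
  assumes countable_states: "\<And>n. countable (S n)"
    and markov: "markov_chain M S Z"
begin

definition path_event :: "int \<Rightarrow> int \<Rightarrow> (int \<Rightarrow> 'a) \<Rightarrow> 'w set" where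
  "path_event k n c = {\<omega> \<in> space M. \<forall>m\<in>{k..n}. Z m \<omega> = c m}"

definition block_event :: "int \<Rightarrow> (int \<Rightarrow> 'a) set \<Rightarrow> 'w set" where
  "block_event n C = {\<omega> \<in> space M. restrict (\<lambda>m. Z m \<omega>) {n..0} \<in> C}"

lemma Z_measurable: "Z n \<in> measurable M (count_space (S n))"
  using markov by (simp add: markov_chain_def)

lemma Z_in_S: "\<omega> \<in> space M \<Longrightarrow> Z n \<omega> \<in> S n"
  using measurable_space[OF Z_measurable] by auto

lemma state_event_sets [measurable]: "{\<omega> \<in> space M. Z n \<omega> \<in> B} \<in> events"
proof -
  have "Z n -` (B \<inter> S n) \<inter> space M \<in> events"
    using Z_measurable by (rule measurable_sets) auto
  moreover have "Z n -` (B \<inter> S n) \<inter> space M = {\<omega> \<in> space M. Z n \<omega> \<in> B}"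
    using Z_in_S by auto
  ultimately show ?thesis by simp
qed

lemma past_sigma_algebra: "sigma_algebra (space M) (past_sigma M S Z n)"
  unfolding past_sigma_def by (rule sigma_algebra_sigma_sets) auto

lemma past_sigma_events: "D \<in> past_sigma M S Z n \<Longrightarrow> D \<in> events"
proof -
  have "(\<Union>m\<in>{..n}. {Z m -` B \<inter> space M | B. B \<subseteq> S m}) \<subseteq> events"
    using measurable_sets[OF Z_measurable] by auto
  then show "D \<in> past_sigma M S Z n \<Longrightarrow> D \<in> events"
    unfolding past_sigma_def using sets.sigma_sets_subset by blast
qed

lemma past_sigma_mono: "k \<le> n \<Longrightarrow> past_sigma M S Z k \<subseteq> past_sigma M S Z n"
  unfolding past_sigma_def by (intro sigma_sets_mono' UN_mono) auto

lemma state_event_past: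
  assumes "m \<le> n" shows "{\<omega> \<in> space M. Z m \<omega> \<in> B} \<in> past_sigma M S Z n"
proof -
  have "{\<omega> \<in> space M. Z m \<omega> \<in> B} = Z m -` (B \<inter> S m) \<inter> space M"
    using Z_in_S by auto
  then show ?thesis
    unfolding past_sigma_def using assms
    by (intro sigma_sets.Basic UN_I[of m]) (auto simp del: vimage_Int)
qed

lemma path_event_past: "path_event k n c \<in> past_sigma M S Z n"
proof -
  interpret past: sigma_algebra "space M" "past_sigma M S Z n"
    by (rule past_sigma_algebra)
  have "{\<omega> \<in> space M. \<forall>m\<in>{k..n}. Z m \<omega> \<in> {c m}} \<in> past_sigma M S Z n"
  proof (rule past.sets_Collect_finite_All)
    fix m assume "m \<in> {k..n}"
    then show "{\<omega> \<in> space M. Z m \<omega> \<in> {c m}} \<in> past_sigma M S Z n"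
      by (intro state_event_past) simp
  qed simp
  then show ?thesis by (simp add: path_event_def)
qed

lemma path_event_sets [measurable]: "path_event k n c \<in> events"
  using path_event_past past_sigma_events by blast

text \<open>Paths ending at time \<open>n\<close> form a \<open>\<pi>\<close>-system: of two such paths either the longer one
  determines the shorter one, or they are incompatible. The state spaces being countable, the
  path events still generate the whole past.\<close>

lemma past_sigma_paths:
  "past_sigma M S Z n =
     sigma_sets (space M) (insert {} {path_event k n c | k c. k \<le> n \<and> (\<forall>m\<in>{k..n}. c m \<in> S m)})"
  (is "_ = sigma_sets _ ?G")
proof
  interpret past: sigma_algebra "space M" "past_sigma M S Z n"
    by (rule past_sigma_algebra)
  interpret gen: sigma_algebra "space M" "sigma_sets (space M) ?G"
    by (rule sigma_algebra_sigma_sets) (auto simp: path_event_def)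
  show "sigma_sets (space M) ?G \<subseteq> past_sigma M S Z n"
    using path_event_past by (intro past.sigma_sets_subset) auto
  have "Z m -` B \<inter> space M \<in> sigma_sets (space M) ?G" if "m \<le> n" for m B
  proof -
    let ?K = "{c \<in> Pi\<^sub>E {m..n} S. c m \<in> B}"
    have "countable ?K"
      by (rule countable_subset[OF _ countable_PiE[of "{m..n}" S]]) (auto intro: countable_states)
    moreover have "path_event m n c \<in> sigma_sets (space M) ?G" if "c \<in> ?K" for c
      using that \<open>m \<le> n\<close> by (intro sigma_sets.Basic) (auto simp: PiE_iff)
    ultimately have "(\<Union>c\<in>?K. path_event m n c) \<in> sigma_sets (space M) ?G"
      by (intro gen.countable_UN') auto
    moreover have "(\<Union>c\<in>?K. path_event m n c) = Z m -` B \<inter> space M"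
    proof
      show "Z m -` B \<inter> space M \<subseteq> (\<Union>c\<in>?K. path_event m n c)"
      proof
        fix \<omega> assume "\<omega> \<in> Z m -` B \<inter> space M"
        then show "\<omega> \<in> (\<Union>c\<in>?K. path_event m n c)"
          using \<open>m \<le> n\<close> Z_in_S
          by (intro UN_I[of "restrict (\<lambda>m. Z m \<omega>) {m..n}"]) (auto simp: path_event_def)
      qed
    qed (use \<open>m \<le> n\<close> in \<open>auto simp: path_event_def\<close>)
    ultimately show ?thesis by simp
  qed
  then show "past_sigma M S Z n \<subseteq> sigma_sets (space M) ?G"
    unfolding past_sigma_def by (intro sigma_sets_mono) auto
qed

lemma Int_stable_paths:
  "Int_stable (insert {} {path_event k n c | k c. k \<le> n \<and> (\<forall>m\<in>{k..n}. c m \<in> S m)})"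
  (is "Int_stable ?G")
proof (rule Int_stableI)
  have compat: "path_event k n c \<inter> path_event l n d \<in> {{}, path_event k n c}" if "k \<le> l"
    for k l c d
  proof (cases "\<forall>m\<in>{l..n}. c m = d m")
    case True
    then show ?thesis using that by (auto simp: path_event_def)
  next
    case False
    then obtain m where "m \<in> {l..n}" "c m \<noteq> d m" by blast
    then have "path_event k n c \<inter> path_event l n d = {}"
      using that by (force simp: path_event_def)
    then show ?thesis by simp
  qed
  fix a b assume a: "a \<in> ?G" and b: "b \<in> ?G"
  show "a \<inter> b \<in> ?G"
  proof (cases "a = {} \<or> b = {}")
    case False
    with a obtain k c where 1: "a = path_event k n c" by blast
    from False b obtain l d where 2: "b = path_event l n d" by blast
    have "a \<inter> b \<in> {{}, a, b}"
      using compat[of k l c d] compat[of l k d c] linear[of k l] unfolding 1 2 Int_commute[of "path_event l n d"]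
      by blast
    moreover have "{{}, a, b} \<subseteq> ?G"
      using a b by (simp only: insert_subset empty_subsetI insertI1 simp_thms)
    ultimately show ?thesis by (rule rev_subsetD)
  qed auto
qed

text \<open>The one-step Markov property for an arbitrary past event \<open>D\<close> instead of a path. It is
  multiplied out: both sides are then measures in \<open>D\<close>, so that agreement on the \<open>\<pi>\<close>-system of
  paths is enough, and null states cause no exception.\<close>

lemma markov_step:
  assumes D: "D \<in> past_sigma M S Z n" and i: "i \<in> S n" and j: "j \<in> S (n + 1)"
  shows "prob (D \<inter> {\<omega> \<in> space M. Z n \<omega> = i \<and> Z (n + 1) \<omega> = j}) * prob {\<omega> \<in> space M. Z n \<omega> = i}
       = prob (D \<inter> {\<omega> \<in> space M. Z n \<omega> = i}) * prob {\<omega> \<in> space M. Z n \<omega> = i \<and> Z (n + 1) \<omega> = j}"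
proof -
  let ?Y = "{\<omega> \<in> space M. Z n \<omega> = i}"
  let ?X = "{\<omega> \<in> space M. Z n \<omega> = i \<and> Z (n + 1) \<omega> = j}"
  let ?G = "insert {} {path_event k n c | k c. k \<le> n \<and> (\<forall>m\<in>{k..n}. c m \<in> S m)}"
  have Y [measurable]: "?Y \<in> events" using state_event_sets[of n "{i}"] by simp
  have "?Y \<inter> {\<omega> \<in> space M. Z (n + 1) \<omega> \<in> {j}} \<in> events"
    by (intro sets.Int Y state_event_sets)
  also have "?Y \<inter> {\<omega> \<in> space M. Z (n + 1) \<omega> \<in> {j}} = ?X" by auto
  finally have X [measurable]: "?X \<in> events" .
  have G: "?G \<subseteq> Pow (space M)" by (auto simp: path_event_def)
  have ev: "C \<in> events" if "C \<in> sigma_sets (space M) ?G" for C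
    using that past_sigma_events past_sigma_paths by blast
  from D have "D \<in> sigma_sets (space M) ?G" by (simp add: past_sigma_paths)
  with Int_stable_paths G show ?thesis
  proof (induction rule: sigma_sets_induct_disjoint)
    case (basic C)
    show ?case
    proof (cases "C \<inter> ?Y = {} \<or> prob C = 0")
      case True
      then show ?thesis
      proof
        assume 0: "C \<inter> ?Y = {}"
        then have "C \<inter> ?X = {}" by auto
        with 0 show ?thesis by simp
      next
        assume 0: "prob C = 0"
        have "C \<in> events" using basic by (intro ev) auto
        then have "prob (C \<inter> ?X) \<le> 0" "prob (C \<inter> ?Y) \<le> 0"
          using finite_measure_mono[of _ C] 0 by (metis Int_lower1)+
        then show ?thesis by (simp add: measure_le_0_iff)
      qed
    next
      case False
      with basic obtain k c where C: "C = path_event k n c" and "k \<le> n"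
        and c: "\<forall>m\<in>{k..n}. c m \<in> S m" by auto
      with False have cn: "c n = i" and pos: "prob (path_event k n c) > 0"
        by (auto simp: path_event_def zero_less_measure_iff)
      have eq: "C \<inter> ?Y = C" "C \<inter> ?X = {\<omega> \<in> space M. Z (n + 1) \<omega> = j \<and> (\<forall>m\<in>{k..n}. Z m \<omega> = c m)}"
        using cn \<open>k \<le> n\<close> by (auto simp: C path_event_def)
      have "\<P>(\<omega> in M. Z (n + 1) \<omega> = j \<bar> \<forall>m\<in>{k..n}. Z m \<omega> = c m) =
            \<P>(\<omega> in M. Z (n + 1) \<omega> = j \<bar> Z n \<omega> = c n)"
        using markov \<open>k \<le> n\<close> c j pos unfolding markov_chain_def path_event_def by blast
      then have "prob (C \<inter> ?X) / prob C = prob ?X / prob ?Y"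
        unfolding cond_prob_def eq cn by (simp add: C path_event_def conj_commute)
      moreover have "prob ?Y > 0"
        using pos finite_measure_mono[of C ?Y] eq(1) Y C by (metis Int_lower2 less_le_trans)
      ultimately show ?thesis using pos unfolding eq(1) by (simp add: C field_simps)
    qed
  next
    case empty
    then show ?case by simp
  next
    case (compl C)
    have "(space M - C) \<inter> U = U - C \<inter> U" if "U \<in> events" for U
      using sets.sets_into_space[OF that] by auto
    then have "prob ((space M - C) \<inter> U) = prob U - prob (C \<inter> U)" if "U \<in> events" for U
      using that ev[OF compl(1)] by (simp add: finite_measure_Diff)
    then show ?case using compl(2) X Y by (simp add: left_diff_distrib right_diff_distrib mult.commute)
  next
    case (union F)
    have "(\<lambda>r. prob (F r \<inter> U)) sums prob ((\<Union>r. F r) \<inter> U)" if "U \<in> events" for U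
    proof -
      have "(\<lambda>r. prob (F r \<inter> U)) sums prob (\<Union>r. F r \<inter> U)"
        using union that ev by (intro finite_measure_UNION) (auto simp: disjoint_family_on_def)
      then show ?thesis by simp
    qed
    from sums_mult2[OF this[OF X], of "prob ?Y"] sums_mult2[OF this[OF Y], of "prob ?X"]
    show ?case using union(3) by (auto intro: sums_unique2)
  qed
qed

lemma path_event_extend:
  assumes "k \<le> l"
  shows "path_event k (l + 1) c = path_event k l c \<inter>
    {\<omega> \<in> space M. Z l \<omega> = c l \<and> Z (l + 1) \<omega> = c (l + 1)}"
proof -
  have "{k..l + 1} = insert (l + 1) {k..l}" using assms by auto
  then show ?thesis using assms by (auto simp: path_event_def)
qed

text \<open>Conditional independence of past and future given the present, obtained by prolonging the
  path one step at a time: \<open>markov_step\<close> at time \<open>l\<close>, applied to \<open>D \<inter> E\<close> and to \<open>E\<close>, shows that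
  one more step multiplies both probabilities by the same transition probability.\<close>

lemma past_given_path:
  assumes D: "D \<in> past_sigma M S Z n" and "n \<le> l" and "\<forall>m\<in>{n..l}. c m \<in> S m"
  shows "prob (D \<inter> path_event n l c) = \<P>(\<omega> in M. \<omega> \<in> D \<bar> Z n \<omega> = c n) * prob (path_event n l c)"
  using assms(2,3)
proof (induction l rule: int_ge_induct)
  case base
  have D': "D \<in> events" using D by (rule past_sigma_events)
  have eq: "path_event n n c = {\<omega> \<in> space M. Z n \<omega> = c n}"
    "D \<inter> path_event n n c = {\<omega> \<in> space M. \<omega> \<in> D \<and> Z n \<omega> = c n}"
    using sets.sets_into_space[OF D'] by (auto simp: path_event_def)
  have "prob (D \<inter> path_event n n c) \<le> prob (path_event n n c)"
    by (rule finite_measure_mono) auto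
  then show ?case
    by (cases "prob (path_event n n c) = 0")
      (simp_all add: cond_prob_def measure_le_0_iff flip: eq)
next
  case (step l)
  let ?E = "path_event n l c"
  let ?Y = "{\<omega> \<in> space M. Z l \<omega> = c l}"
  let ?X = "{\<omega> \<in> space M. Z l \<omega> = c l \<and> Z (l + 1) \<omega> = c (l + 1)}"
  let ?g = "\<P>(\<omega> in M. \<omega> \<in> D \<bar> Z n \<omega> = c n)"
  interpret past: sigma_algebra "space M" "past_sigma M S Z l"
    by (rule past_sigma_algebra)
  have E: "?E \<in> past_sigma M S Z l" by (rule path_event_past)
  have DE: "D \<inter> ?E \<in> past_sigma M S Z l"
    using D E past_sigma_mono[OF step(1)] by blast
  have cS: "c l \<in> S l" "c (l + 1) \<in> S (l + 1)" using step by auto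
  have EY: "?E \<inter> ?Y = ?E" using step by (auto simp: path_event_def)
  have ext: "path_event n (l + 1) c = ?E \<inter> ?X" using step(1) by (rule path_event_extend)
  have IH: "prob (D \<inter> ?E) = ?g * prob ?E" using step by auto
  have "prob (D \<inter> ?E \<inter> ?X) * prob ?Y = ?g * prob ?E * prob ?X"
    using markov_step[OF DE cS] by (simp add: Int_assoc EY IH)
  also have "\<dots> = ?g * prob (?E \<inter> ?X) * prob ?Y"
    using markov_step[OF E cS] by (simp add: EY)
  finally have *: "prob (D \<inter> ?E \<inter> ?X) * prob ?Y = ?g * prob (?E \<inter> ?X) * prob ?Y" .
  show ?case
  proof (cases "prob ?Y = 0")
    case True
    have "?Y \<in> events" using state_event_sets[of l "{c l}"] by simp
    then have "prob (D \<inter> ?E \<inter> ?X) \<le> prob ?Y" "prob (?E \<inter> ?X) \<le> prob ?Y"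
      by (auto intro!: finite_measure_mono)
    then show ?thesis using True by (simp add: ext Int_assoc measure_le_0_iff)
  next
    case False
    then show ?thesis using * by (simp add: ext Int_assoc)
  qed
qed

section \<open>Approximation by events that depend on finitely many coordinates\<close>

lemma restrict_path_eq:
  assumes "\<omega> \<in> path_event n 0 c" "c \<in> Pi\<^sub>E {n..0} S"
  shows "restrict (\<lambda>m. Z m \<omega>) {n..0} = c"
proof
  fix m show "restrict (\<lambda>m. Z m \<omega>) {n..0} m = c m"
    using assms(1) PiE_arb[OF assms(2), of m] by (cases "m \<in> {n..0}") (auto simp: path_event_def)
qed

lemma block_event_paths:
  "block_event n C = (\<Union>c\<in>C \<inter> Pi\<^sub>E {n..0} S. path_event n 0 c)"
proof
  show "block_event n C \<subseteq> (\<Union>c\<in>C \<inter> Pi\<^sub>E {n..0} S. path_event n 0 c)"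
  proof
    fix \<omega> assume "\<omega> \<in> block_event n C"
    then show "\<omega> \<in> (\<Union>c\<in>C \<inter> Pi\<^sub>E {n..0} S. path_event n 0 c)"
      using Z_in_S
      by (intro UN_I[of "restrict (\<lambda>m. Z m \<omega>) {n..0}"]) (auto simp: path_event_def block_event_def)
  qed
  show "(\<Union>c\<in>C \<inter> Pi\<^sub>E {n..0} S. path_event n 0 c) \<subseteq> block_event n C"
  proof
    fix \<omega> assume "\<omega> \<in> (\<Union>c\<in>C \<inter> Pi\<^sub>E {n..0} S. path_event n 0 c)"
    then obtain c where c: "c \<in> C" "c \<in> Pi\<^sub>E {n..0} S" and w: "\<omega> \<in> path_event n 0 c" by auto
    have "restrict (\<lambda>m. Z m \<omega>) {n..0} = c"
      using w c(2) by (rule restrict_path_eq)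
    then show "\<omega> \<in> block_event n C" using c w by (simp add: block_event_def path_event_def)
  qed
qed

lemma countable_paths: "countable (C \<inter> Pi\<^sub>E {n..0} S)"
  by (rule countable_subset[OF _ countable_PiE[of "{n..0}" S]]) (auto intro: countable_states)

lemma block_event_sets [measurable]: "block_event n C \<in> events"
  unfolding block_event_paths using countable_paths by (intro sets.countable_UN') auto

lemma block_event_refine:
  assumes "n' \<le> n"
  shows "block_event n C = block_event n' {c. restrict c {n..0} \<in> C}"
proof -
  have "restrict (restrict (\<lambda>m. Z m \<omega>) {n'..0}) {n..0} = restrict (\<lambda>m. Z m \<omega>) {n..0}" for \<omega>
    using assms by (auto simp: restrict_def fun_eq_iff)
  then show ?thesis by (simp add: block_event_def)
qed

definition approximable :: "'w set \<Rightarrow> bool" where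
  "approximable D \<longleftrightarrow> D \<in> events \<and>
     (\<forall>e>0. \<exists>n\<le>0. \<exists>C. prob (sym_diff D (block_event n C)) < e)"

lemma approximable_Un:
  assumes D: "approximable D" and E: "approximable E"
  shows "approximable (D \<union> E)"
  unfolding approximable_def
proof (intro conjI allI impI)
  have [measurable]: "D \<in> events" "E \<in> events" using D E by (auto simp: approximable_def)
  then show "D \<union> E \<in> events" by auto
  fix e :: real assume "e > 0"
  then have "e / 2 > 0" by simp
  then obtain n C k B where n: "n \<le> 0" "prob (sym_diff D (block_event n C)) < e / 2"
    and k: "k \<le> 0" "prob (sym_diff E (block_event k B)) < e / 2"
    using D E unfolding approximable_def by meson
  obtain C' where C': "block_event n C = block_event (min n k) C'"
    using block_event_refine[of "min n k" n C] by auto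
  obtain B' where B': "block_event k B = block_event (min n k) B'"
    using block_event_refine[of "min n k" k B] by auto
  let ?U = "block_event (min n k) (C' \<union> B')"
  have U: "?U = block_event n C \<union> block_event k B"
    unfolding C' B' by (auto simp: block_event_def)
  have "prob (sym_diff (D \<union> E) ?U) \<le>
      prob (sym_diff D (block_event n C) \<union> sym_diff E (block_event k B))"
    unfolding U by (rule finite_measure_mono) auto
  also have "\<dots> \<le> prob (sym_diff D (block_event n C)) + prob (sym_diff E (block_event k B))"
    by (rule measure_Un_le) auto
  also have "\<dots> < e" using n k by simp
  finally show "\<exists>n\<le>0. \<exists>C. prob (sym_diff (D \<union> E) (block_event n C)) < e"
    using n(1) by (intro exI[of _ "min n k"]) auto
qed

lemma approximable_block: "n \<le> 0 \<Longrightarrow> approximable (block_event n C)"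
  unfolding approximable_def
proof (intro conjI allI impI)
  fix e :: real assume "n \<le> 0" "0 < e"
  then show "\<exists>k\<le>0. \<exists>B. prob (sym_diff (block_event n C) (block_event k B)) < e"
    by (intro exI[of _ n] conjI exI[of _ C]) auto
qed simp

text \<open>The approximable events form a \<open>\<sigma>\<close>-algebra: a countable union is close to a finite one,
  and finitely many blocks can be extended to the longest of them.\<close>

lemma approximable_past:
  assumes "D \<in> past_sigma M S Z 0"
  shows "approximable D"
  using assms unfolding past_sigma_def
proof (induction rule: sigma_sets.induct)
  case (Basic D)
  then obtain m B where m: "m \<le> 0" and D: "D = Z m -` B \<inter> space M" by auto
  have "D = block_event m {c. c m \<in> B}" using m by (auto simp: D block_event_def)
  then show ?case using m by (simp add: approximable_block)
next
  case Empty
  have "{} = block_event 0 {}" by (simp add: block_event_def)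
  then show ?case using approximable_block[of 0 "{}"] by simp
next
  case (Compl D)
  have "sym_diff (space M - D) (block_event n (- C)) = sym_diff D (block_event n C)" for n C
    using sets.sets_into_space[of D M] Compl(2) by (auto simp: block_event_def approximable_def)
  then show ?case using Compl(2) unfolding approximable_def by (metis sets.compl_sets)
next
  case (Union F)
  have F [measurable]: "F i \<in> events" for i using Union(2) by (simp add: approximable_def)
  have fin: "approximable (\<Union>i<N. F i)" for N
  proof (induction N)
    case 0
    have "{} = block_event 0 {}" by (simp add: block_event_def)
    then show ?case using approximable_block[of 0 "{}"] by simp
  next
    case (Suc N)
    then show ?case using approximable_Un[OF Suc Union(2)[of N]] by (simp add: lessThan_Suc Un_commute)
  qed
  show ?case unfolding approximable_def
  proof (intro conjI allI impI)
    show "(\<Union>i. F i) \<in> events" by auto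
    fix e :: real assume "e > 0"
    have "(\<lambda>N. prob (\<Union>i<N. F i)) \<longlonglongrightarrow> prob (\<Union>N. \<Union>i<N. F i)"
      by (rule finite_Lim_measure_incseq) (auto simp: incseq_def intro: less_le_trans)
    also have "(\<Union>N. \<Union>i<N. F i) = (\<Union>i. F i)" by auto
    finally have "eventually (\<lambda>N. prob (\<Union>i<N. F i) > prob (\<Union>i. F i) - e / 2) sequentially"
      using \<open>e > 0\<close> by (intro order_tendstoD) auto
    then obtain N where N: "prob (\<Union>i<N. F i) > prob (\<Union>i. F i) - e / 2"
      by (auto simp: eventually_sequentially)
    obtain n C where n: "n \<le> 0" and C: "prob (sym_diff (\<Union>i<N. F i) (block_event n C)) < e / 2"
      using fin[of N] \<open>e > 0\<close> unfolding approximable_def by (meson half_gt_zero)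
    have "prob (sym_diff (\<Union>i. F i) (block_event n C)) \<le>
      prob (((\<Union>i. F i) - (\<Union>i<N. F i)) \<union> sym_diff (\<Union>i<N. F i) (block_event n C))"
      by (rule finite_measure_mono) auto
    also have "\<dots> \<le> prob ((\<Union>i. F i) - (\<Union>i<N. F i)) + prob (sym_diff (\<Union>i<N. F i) (block_event n C))"
      by (rule measure_Un_le) auto
    also have "prob ((\<Union>i. F i) - (\<Union>i<N. F i)) = prob (\<Union>i. F i) - prob (\<Union>i<N. F i)"
      by (rule finite_measure_Diff) auto
    finally show "\<exists>n\<le>0. \<exists>C. prob (sym_diff (\<Union>i. F i) (block_event n C)) < e"
      using n N C by (intro exI[of _ n] conjI exI[of _ C]) auto
  qed
qed

section \<open>Reading off an entrance event from the current state\<close>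

lemma prob_ge_on_partition:
  assumes K: "countable K" and E: "\<And>c. c \<in> K \<Longrightarrow> E c \<in> events" and disj: "disjoint_family_on E K"
    and T: "T \<in> events" and "0 \<le> d"
    and le: "\<And>c. c \<in> K \<Longrightarrow> d * prob (E c) \<le> prob (T \<inter> E c)"
  shows "d * prob (\<Union>c\<in>K. E c) \<le> prob T"
proof -
  have "ennreal d * emeasure M (\<Union>c\<in>K. E c) = (\<integral>\<^sup>+c. ennreal d * emeasure M (E c) \<partial>count_space K)"
    using E by (simp add: emeasure_UN_countable[OF _ K disj] nn_integral_cmult)
  also have "\<dots> \<le> (\<integral>\<^sup>+c. emeasure M (T \<inter> E c) \<partial>count_space K)"
    using le \<open>0 \<le> d\<close>
    by (intro nn_integral_mono) (auto simp: emeasure_eq_measure simp flip: ennreal_mult intro!: ennreal_leI)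
  also have "\<dots> = emeasure M (\<Union>c\<in>K. T \<inter> E c)"
    using E T disj by (intro emeasure_UN_countable[OF _ K, symmetric]) (auto simp: disjoint_family_on_def)
  also have "\<dots> \<le> emeasure M T" using T by (intro emeasure_mono) auto
  finally show ?thesis
    using \<open>0 \<le> d\<close> by (simp add: emeasure_eq_measure flip: ennreal_mult)
qed

text \<open>The gap \<open>d\<close> makes every path on which \<open>I\<close> and \<open>C\<close> disagree cost a fixed proportion of its
  probability: either \<open>A\<close> has conditional probability at least \<open>d\<close> on a path outside the block
  event, or its complement has on a path inside it.\<close>

lemma state_set_vs_block:
  assumes A: "A \<in> past_sigma M S Z n" and n: "n \<le> 0" and "0 \<le> d"
    and up: "\<And>i. i \<in> S n \<Longrightarrow> i \<in> I \<Longrightarrow> d \<le> \<P>(\<omega> in M. \<omega> \<in> A \<bar> Z n \<omega> = i)"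
    and down: "\<And>i. i \<in> S n \<Longrightarrow> i \<notin> I \<Longrightarrow> \<P>(\<omega> in M. \<omega> \<in> A \<bar> Z n \<omega> = i) \<le> 1 - d"
  shows "d * prob (sym_diff {\<omega> \<in> space M. Z n \<omega> \<in> I} (block_event n C))
    \<le> prob (sym_diff A (block_event n C))"
proof -
  let ?B = "block_event n C"
  let ?K = "{c. (c n \<in> I) \<noteq> (c \<in> C)} \<inter> Pi\<^sub>E {n..0} S"
  have Aev [measurable]: "A \<in> events" using A by (rule past_sigma_events)
  have "sym_diff {\<omega> \<in> space M. Z n \<omega> \<in> I} ?B = block_event n {c. (c n \<in> I) \<noteq> (c \<in> C)}"
    using n by (auto simp: block_event_def)
  also have "\<dots> = (\<Union>c\<in>?K. path_event n 0 c)" by (rule block_event_paths)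
  finally have U: "sym_diff {\<omega> \<in> space M. Z n \<omega> \<in> I} ?B = (\<Union>c\<in>?K. path_event n 0 c)" .
  have disj: "disjoint_family_on (path_event n 0) ?K"
    unfolding disjoint_family_on_def
  proof (intro ballI impI)
    fix c c' assume "c \<in> ?K" "c' \<in> ?K" "c \<noteq> c'"
    then show "path_event n 0 c \<inter> path_event n 0 c' = {}"
      using restrict_path_eq[of _ n c] restrict_path_eq[of _ n c'] by auto
  qed
  have "d * prob (path_event n 0 c) \<le> prob (sym_diff A ?B \<inter> path_event n 0 c)" if c: "c \<in> ?K" for c
  proof -
    let ?E = "path_event n 0 c"
    let ?g = "\<P>(\<omega> in M. \<omega> \<in> A \<bar> Z n \<omega> = c n)"
    have cS: "\<forall>m\<in>{n..0}. c m \<in> S m" using c by auto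
    have g: "prob (A \<inter> ?E) = ?g * prob ?E" by (rule past_given_path[OF A n cS])
    have cn: "c n \<in> S n" using cS n by auto
    show ?thesis
    proof (cases "c \<in> C")
      case True
      have "?E \<subseteq> ?B"
        using restrict_path_eq[of _ n c] c True by (auto simp: block_event_def) (simp add: path_event_def)
      then have "sym_diff A ?B \<inter> ?E = ?E - A \<inter> ?E" by auto
      then have "prob (sym_diff A ?B \<inter> ?E) = (1 - ?g) * prob ?E"
        by (simp add: finite_measure_Diff g algebra_simps)
      moreover have "d \<le> 1 - ?g" using down[OF cn] c True by auto
      ultimately show ?thesis by (simp add: mult_right_mono)
    next
      case False
      have "?E \<inter> ?B = {}" using restrict_path_eq[of _ n c] c False by (auto simp: block_event_def)
      then have "sym_diff A ?B \<inter> ?E = A \<inter> ?E" by auto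
      moreover have "d \<le> ?g" using up[OF cn] c False by auto
      ultimately show ?thesis by (simp add: g mult_right_mono)
    qed
  qed
  then show ?thesis
    unfolding U using \<open>0 \<le> d\<close> disj countable_paths by (intro prob_ge_on_partition) auto
qed

text \<open>The gap \<open>d\<close> may not depend on \<open>n\<close>: the error is \<open>P(J \<triangle> A) \<le> P(J \<triangle> B) + P(B \<triangle> A)\<close>, at most
  \<open>1 / d + 1\<close> times the error made in approximating \<open>A\<close> by one fixed block event \<open>B\<close>.\<close>

lemma state_sets_approach_event:
  assumes A: "A \<in> entrance_sigma M S Z" and d: "0 < d"
    and up: "\<And>n i. i \<in> S n \<Longrightarrow> i \<in> I n \<Longrightarrow> d \<le> \<P>(\<omega> in M. \<omega> \<in> A \<bar> Z n \<omega> = i)"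
    and down: "\<And>n i. i \<in> S n \<Longrightarrow> i \<notin> I n \<Longrightarrow> \<P>(\<omega> in M. \<omega> \<in> A \<bar> Z n \<omega> = i) \<le> 1 - d"
  shows "((\<lambda>n. prob (sym_diff {\<omega> \<in> space M. Z n \<omega> \<in> I n} A)) \<longlongrightarrow> 0) at_bot"
proof (rule order_tendstoI)
  have past: "A \<in> past_sigma M S Z n" if "n \<le> 0" for n
    using A that by (auto simp: entrance_sigma_def)
  have Aev [measurable]: "A \<in> events" using past[of 0] past_sigma_events by auto
  fix e :: real assume "0 < e"
  then have "0 < e / (1 / d + 1)" using d by (intro divide_pos_pos add_pos_pos) auto
  then obtain k C where k: "k \<le> 0" and C: "prob (sym_diff A (block_event k C)) < e / (1 / d + 1)"
    using approximable_past[OF past[of 0]] unfolding approximable_def by blast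
  let ?B = "block_event k C"
  have "prob (sym_diff {\<omega> \<in> space M. Z n \<omega> \<in> I n} A) < e" if "n \<le> k" for n
  proof -
    let ?J = "{\<omega> \<in> space M. Z n \<omega> \<in> I n}"
    have "d * prob (sym_diff ?J ?B) \<le> prob (sym_diff A ?B)"
      unfolding block_event_refine[OF that]
      using that k d up down past by (intro state_set_vs_block) auto
    then have "prob (sym_diff ?J ?B) \<le> prob (sym_diff A ?B) / d"
      using d by (simp add: field_simps)
    moreover have "prob (sym_diff ?J A) \<le> prob (sym_diff ?J ?B \<union> sym_diff A ?B)"
      by (rule finite_measure_mono) auto
    moreover have "\<dots> \<le> prob (sym_diff ?J ?B) + prob (sym_diff A ?B)"
      by (rule measure_Un_le) auto
    ultimately have "prob (sym_diff ?J A) \<le> prob (sym_diff A ?B) * (1 / d + 1)"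
      by (simp add: algebra_simps)
    also have "\<dots> < e" using C d by (simp add: pos_less_divide_eq add_pos_pos)
    finally show ?thesis .
  qed
  then show "eventually (\<lambda>n. prob (sym_diff {\<omega> \<in> space M. Z n \<omega> \<in> I n} A) < e) at_bot"
    by (auto simp: eventually_at_bot_linorder)
qed (auto intro!: always_eventually intro: less_le_trans[OF _ measure_nonneg])

lemma prob_tendsto_of_sym_diff:
  assumes X: "\<And>n. X n \<in> events" and A: "A \<in> events"
    and lim: "((\<lambda>n. prob (sym_diff (X n) A)) \<longlongrightarrow> 0) F"
  shows "((\<lambda>n. prob (X n)) \<longlongrightarrow> prob A) F"
proof -
  have le: "prob B \<le> prob C + prob (sym_diff B C)" if [measurable]: "B \<in> events" "C \<in> events" for B C
  proof -
    have "prob B \<le> prob (C \<union> sym_diff B C)" by (rule finite_measure_mono) auto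
    also have "\<dots> \<le> prob C + prob (sym_diff B C)" by (rule measure_Un_le) auto
    finally show ?thesis .
  qed
  have "norm (prob (X n) - prob A) \<le> prob (sym_diff (X n) A)" for n
    using le[OF X[of n] A] le[OF A X[of n]] by (simp add: Un_commute abs_le_iff)
  then have "\<forall>n. norm (prob (X n) - prob A) \<le> prob (sym_diff (X n) A)" ..
  then have "((\<lambda>n. prob (X n) - prob A) \<longlongrightarrow> 0) F"
    by (rule Lim_null_comparison[OF always_eventually lim])
  then show ?thesis by (simp add: LIM_zero_iff)
qed

end

theorem mainTheorem2:
  fixes M :: "'w measure"
    and S :: "int \<Rightarrow> 'a set"
    and Z :: "int \<Rightarrow> 'w \<Rightarrow> 'a"
    and A :: "'w set"
    and p q :: real
  assumes "prob_space M"
    and "\<And>n. countable (S n)"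
    and "markov_chain M S Z"
    and "A \<in> entrance_sigma M S Z"
    and "0 < p" and "p < q" and "q < 1"
  shows
    "((\<lambda>n. \<P>(\<omega> in M. Z n \<omega> \<in> level_states M S Z A n q 1)) \<longlongrightarrow> measure M A) at_bot \<and>
     ((\<lambda>n. \<P>(\<omega> in M. Z n \<omega> \<in> level_states M S Z A n p q)) \<longlongrightarrow> 0) at_bot \<and>
     ((\<lambda>n. \<P>(\<omega> in M. Z n \<omega> \<in> level_states M S Z A n 0 p)) \<longlongrightarrow> 1 - measure M A) at_bot \<and>
     ((\<lambda>n. measure M (sym_diff {\<omega> \<in> space M. Z n \<omega> \<in> level_states M S Z A n q 1} A))
        \<longlongrightarrow> 0) at_bot \<and>
     ((\<lambda>n. measure M {\<omega> \<in> space M. Z n \<omega> \<in> level_states M S Z A n p q}) \<longlongrightarrow> 0) at_bot \<and>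
     ((\<lambda>n. measure M (sym_diff {\<omega> \<in> space M. Z n \<omega> \<in> level_states M S Z A n 0 p} (space M - A)))
        \<longlongrightarrow> 0) at_bot"
proof -
  interpret countable_markov_chain M S Z
    using assms by (simp add: countable_markov_chain_def countable_markov_chain_axioms_def)
  let ?L = "\<lambda>a b n. {\<omega> \<in> space M. Z n \<omega> \<in> level_states M S Z A n a b}"
  let ?g = "\<lambda>n i. \<P>(\<omega> in M. \<omega> \<in> A \<bar> Z n \<omega> = i)"
  have "A \<in> past_sigma M S Z 0" using assms(4) by (simp add: entrance_sigma_def)
  then have A: "A \<in> events" by (rule past_sigma_events)
  have g0: "0 \<le> ?g n i" for n i by (simp add: cond_prob_def)
  have g1: "?g n i \<le> 1" for n i
  proof -
    have "{\<omega> \<in> space M. Z n \<omega> = i} \<in> events" using state_event_sets[of n "{i}"] by simp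
    then have "prob {\<omega> \<in> space M. \<omega> \<in> A \<and> Z n \<omega> = i} \<le> prob {\<omega> \<in> space M. Z n \<omega> = i}"
      by (intro finite_measure_mono) auto
    then show ?thesis by (simp add: cond_prob_def divide_le_eq_1 measure_nonneg less_le)
  qed
  have high: "((\<lambda>n. prob (sym_diff (?L r 1 n) A)) \<longlongrightarrow> 0) at_bot" if "0 < r" "r < 1" for r
    using assms(4) that g1
    by (intro state_sets_approach_event[where d = "min r (1 - r)"]) (auto simp: level_states_def)
  have low: "((\<lambda>n. prob (sym_diff (?L 0 r n) (space M - A))) \<longlongrightarrow> 0) at_bot"
    if "0 < r" "r < 1" for r
  proof -
    have "((\<lambda>n. prob (sym_diff {\<omega> \<in> space M. Z n \<omega> \<in> - level_states M S Z A n 0 r} A)) \<longlongrightarrow> 0) at_bot"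
      using assms(4) that g0
      by (intro state_sets_approach_event[where d = "min r (1 - r)"]) (auto simp: level_states_def)
    moreover have "sym_diff {\<omega> \<in> space M. Z n \<omega> \<in> - level_states M S Z A n 0 r} A =
        sym_diff (?L 0 r n) (space M - A)" for n
      using sets.sets_into_space[OF A] by auto
    ultimately show ?thesis by simp
  qed
  have pq: "0 < q" "p < 1" using assms by auto
  have mid: "((\<lambda>n. prob (?L p q n)) \<longlongrightarrow> 0) at_bot"
  proof (rule tendsto_sandwich[OF _ _ tendsto_const])
    have "prob (?L p q n) \<le> prob (sym_diff (?L p 1 n) A) + prob (sym_diff (?L 0 q n) (space M - A))" for n
    proof -
      have "prob (?L p q n) \<le> prob (sym_diff (?L p 1 n) A \<union> sym_diff (?L 0 q n) (space M - A))"
      proof (rule finite_measure_mono)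
        show "?L p q n \<subseteq> sym_diff (?L p 1 n) A \<union> sym_diff (?L 0 q n) (space M - A)"
          using g0 g1 by (auto simp: level_states_def)
        show "sym_diff (?L p 1 n) A \<union> sym_diff (?L 0 q n) (space M - A) \<in> events"
          using A by auto
      qed
      also have "\<dots> \<le> prob (sym_diff (?L p 1 n) A) + prob (sym_diff (?L 0 q n) (space M - A))"
        using A by (intro measure_Un_le) auto
      finally show ?thesis .
    qed
    then show "\<forall>\<^sub>F n in at_bot. prob (?L p q n) \<le>
        prob (sym_diff (?L p 1 n) A) + prob (sym_diff (?L 0 q n) (space M - A))"
      by (auto intro: always_eventually)
    show "((\<lambda>n. prob (sym_diff (?L p 1 n) A) + prob (sym_diff (?L 0 q n) (space M - A))) \<longlongrightarrow> 0) at_bot"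
      using tendsto_add[OF high[OF assms(5) pq(2)] low[OF pq(1) assms(7)]] by simp
  qed (auto intro: always_eventually)
  have "((\<lambda>n. prob (?L q 1 n)) \<longlongrightarrow> prob A) at_bot"
    using A high[OF pq(1) assms(7)] by (intro prob_tendsto_of_sym_diff) auto
  moreover have "((\<lambda>n. prob (?L 0 p n)) \<longlongrightarrow> 1 - prob A) at_bot"
    unfolding prob_compl[OF A, symmetric]
    using A low[OF assms(5) pq(2)] by (intro prob_tendsto_of_sym_diff) auto
  ultimately show ?thesis
    using mid high[OF pq(1) assms(7)] low[OF assms(5) pq(2)] by blast
qed

end
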